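(* Let $f_1,\dots,f_m:[0,1]\to[0,1]$ and a probability vector $(p_1,\dots,p_m)$ satisfy: (A1) each $f_i$ is an increasing $C^2$ diffeomorphism of $[0,1]$; (A2) for every $x\in(0,1)$ there exist $i,j\in\{1,\dots,m\}$ with $f_i(x)<x<f_j(x)$; (A3) the expected Lyapunov exponents at the boundary points, $\Lambda_0=\sum_{i=1}^m p_i\log f_i'(0)$ and $\Lambda_1=\sum_{i=1}^m p_i\log f_i'(1)$, are positive. Then for every $x,y\in(0,1)$ there exist $C\ge 1$ and $q\in(0,1)$ such that $$\mathbb{E}\,|f^n_\omega(x)-f^n_\omega(y)|\le Cq^n\quad\text{for } n\ge 1.$$
   Context: Let $\Sigma=\{1,\dots,m\}^{\mathbb{N}}$, $\mathbb{N}=\{1,2,\dots\}$, with the product $\sigma$-field and the infinite product measure $\mathbb{P}$ of the measure $(p_1,\dots,p_m)$ on $\{1,\dots,m\}$; $\mathbb{E}$ denotes expectation with respect to $\mathbb{P}$. For $\omega=(\omega_1,\omega_2,\dots)\in\Sigma$ put $f^n_\omega=f_{\omega_n}\circ\cdots\circ f_{\omega_1}$ for $n\ge1$ and $f^0_\omega=\mathrm{id}$. A $C^2$ diffeomorphism of $[0,1]$ is a $C^2$ bijection with $C^2$ inverse (one-sided derivatives at the endpoints), so an increasing one fixes $0$ and $1$.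
   Formalization: The probability vector is assumed to have all p_i > 0; with zero weights allowed the claim fails, e.g. p_1 = 1 with f_1 having two attracting interior fixed points and (A2) supplied only by maps of weight zero. *)

theory Defs
  imports "HOL-Probability.Probability"
begin

text \<open>Derivatives are taken within \<open>S\<close>, hence one-sided at the endpoints when \<open>S\<close> is a
  compact interval.\<close>

definition C2_on :: "real set \<Rightarrow> (real \<Rightarrow> real) \<Rightarrow> bool" where
  "C2_on S g \<longleftrightarrow>
     (\<exists>g' g''. (\<forall>x\<in>S. (g has_real_derivative g' x) (at x within S)) \<and>
               (\<forall>x\<in>S. (g' has_real_derivative g'' x) (at x within S)) \<and>
               continuous_on S g'')"

definition increasing_C2_diffeo :: "(real \<Rightarrow> real) \<Rightarrow> bool" where
  "increasing_C2_diffeo g \<longleftrightarrow>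
     bij_betw g {0..1} {0..1} \<and> strict_mono_on {0..1} g \<and>
     C2_on {0..1} g \<and> C2_on {0..1} (the_inv_into {0..1} g)"

text \<open>The derivative of a real function on the unit interval, one-sided at 0 and 1.\<close>

definition deriv01 :: "(real \<Rightarrow> real) \<Rightarrow> real \<Rightarrow> real" where
  "deriv01 g x = vector_derivative g (at x within {0..1})"

text \<open>Sequences are indexed from 1, so their coordinate 0 is irrelevant: it lies outside the index
  set of the product measure.\<close>

definition bernoulli_measure :: "nat \<Rightarrow> (nat \<Rightarrow> real) \<Rightarrow> (nat \<Rightarrow> nat) measure" where
  "bernoulli_measure m p = (\<Pi>\<^sub>M n\<in>{1..}. point_measure {1..m} (\<lambda>i. ennreal (p i)))"

primrec random_iterate :: "(nat \<Rightarrow> real \<Rightarrow> real) \<Rightarrow> (nat \<Rightarrow> nat) \<Rightarrow> nat \<Rightarrow> real \<Rightarrow> real" where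
  "random_iterate f \<omega> 0 = id"
| "random_iterate f \<omega> (Suc n) = f (\<omega> (Suc n)) \<circ> random_iterate f \<omega> n"

end

theory Submission imports Defs begin

text \<open>Since the maps are increasing, the expected distance of two orbits is the difference
  \<open>P^n g y - P^n g x\<close> of iterates of the transfer operator on \<open>g z = z\<close>, and this depends only on
  the laws of the two orbits. So they may be coupled independently, and the expected distance is at
  most the probability that the two independent copies have not yet crossed.  Positive Lyapunov
  exponents make \<open>x powr -\<alpha>\<close> contract in mean near 0 (similarly at 1), so the copies quickly return
  to a compact subinterval, where (A2) yields a crossing with probability bounded below.\<close>

text \<open>Two orbits driven by the same maps keep their order forever, so a crossing can only come
  from independent choices. Once crossed, a pair contributes nothing positive and is killed, which
  leaves a sub-Markov operator \<open>Q\<close> on ordered pairs.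

  The obstacle is that return to a compact set is measured by an unbounded weight, while the
  crossing probability is bounded below only over a block of \<open>N\<close> steps and only for
  pairs in the compact set. Instead of splitting time into excursions and returns, both effects are
  put into a single weight \<open>V\<close> \<ge> 1 with the one-step inequality
  \<open>Q V x y \<le> q * V x y\<close>. Iterating it gives the exponential bound, with
  \<open>V x y\<close> as the constant and a rate \<open>q\<close> common to all pairs.

  Order halves the work near the endpoints: for x < y it suffices to keep the lower point away from
  0 and the upper point away from 1. A crossing needs the lower copy to be at or above 1/2 and the
  upper copy at or below 1/2 at the same time, which is why the hitting estimates hold for every
  sufficiently large number of steps.\<close>

section \<open>Derivatives of increasing diffeomorphisms\<close>

lemma increasing_C2_diffeo_derivative:
  assumes "increasing_C2_diffeo g" "x \<in> {0..1}"
  shows "(g has_real_derivative deriv01 g x) (at x within {0..1})" "deriv01 g x > 0"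
proof -
  let ?h = "the_inv_into {0..1} g"
  have bij: "bij_betw g {0..1} {0..1}" and mono: "strict_mono_on {0..1} g"
    using assms(1) by (auto simp: increasing_C2_diffeo_def)
  have img: "g ` {0..1} = {0..1}" and inj: "inj_on g {0..1}"
    using bij by (auto simp: bij_betw_def)
  have gx: "g x \<in> {0..1}" using img assms(2) by blast
  obtain D where D: "(g has_real_derivative D) (at x within {0..1})"
    using assms unfolding increasing_C2_diffeo_def C2_on_def by blast
  obtain E where E: "(?h has_real_derivative E) (at (g x) within {0..1})"
    using assms(1) gx unfolding increasing_C2_diffeo_def C2_on_def by blast
  have D_eq: "deriv01 g x = D"
    unfolding deriv01_def
    using D assms(2) vector_derivative_within_cbox[of 0 1 x g D]
    by (simp add: has_real_derivative_iff_has_vector_derivative)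
  \<comment> \<open>Strict monotonicity alone would allow a zero derivative; differentiating the
    identity as inverse after \<open>g\<close> gives \<open>E * D = 1\<close> and excludes it.
    Uniqueness of derivatives within the closed interval covers the endpoints too.\<close>
  have "(?h \<circ> g has_real_derivative E * D) (at x within {0..1})"
    using DERIV_image_chain[of ?h E g x "{0..1}" D] E D img by simp
  moreover have "((\<lambda>x. x) has_real_derivative E * D) (at x within {0..1})
      \<longleftrightarrow> (?h \<circ> g has_real_derivative E * D) (at x within {0..1})"
    by (rule has_field_derivative_cong_eventually)
       (use assms(2) in \<open>auto simp: eventually_at_filter the_inv_into_f_f[OF inj]\<close>)
  ultimately have "((\<lambda>x. x) has_real_derivative E * D) (at x within cbox 0 1)" by simp
  moreover have "((\<lambda>x. x) has_real_derivative 1) (at x within cbox 0 1)"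
    by (rule DERIV_ident)
  ultimately have "E * D = 1"
    using assms(2) vector_derivative_within_cbox[of 0 1 x "\<lambda>x. x" "E * D"]
      vector_derivative_within_cbox[of 0 1 x "\<lambda>x. x" 1]
    by (simp add: has_real_derivative_iff_has_vector_derivative)
  then have "D \<noteq> 0" by auto
  moreover have "D \<ge> 0"
  proof (rule tendsto_lowerbound)
    show "((\<lambda>y. (g y - g x) / (y - x)) \<longlongrightarrow> D) (at x within {0..1})"
      using D by (simp add: has_field_derivative_iff)
    show "\<forall>\<^sub>F y in at x within {0..1}. 0 \<le> (g y - g x) / (y - x)"
      unfolding eventually_at_filter
    proof (intro always_eventually allI impI)
      fix y :: real assume "y \<noteq> x" "y \<in> {0..1}"
      then show "0 \<le> (g y - g x) / (y - x)"
        using strict_mono_onD[OF mono, of x y] strict_mono_onD[OF mono, of y x] assms(2)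
        by (cases x y rule: linorder_cases)
           (auto simp: divide_simps)
    qed
    show "at x within {0..1} \<noteq> bot"
      using assms(2) by (simp add: trivial_limit_within islimpt_Icc)
  qed
  ultimately show "(g has_real_derivative deriv01 g x) (at x within {0..1})" "deriv01 g x > 0"
    using D D_eq by auto
qed

section \<open>The averaging operator and expectations along random orbits\<close>

definition transfer :: "nat \<Rightarrow> (nat \<Rightarrow> real) \<Rightarrow> (nat \<Rightarrow> real \<Rightarrow> real) \<Rightarrow> (real \<Rightarrow> real) \<Rightarrow> real \<Rightarrow> real" where
  "transfer m p f g x = (\<Sum>i=1..m. p i * g (f i x))"

lemma random_iterate_restrict:
  "{1..n} \<subseteq> J \<Longrightarrow> random_iterate f (restrict \<omega> J) n = random_iterate f \<omega> n"
proof (induction n)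
  case (Suc n)
  then have "{1..n} \<subseteq> J" "Suc n \<in> J" by auto
  with Suc.IH show ?case by simp
qed simp

lemma random_iterate_in:
  assumes "\<And>k. k \<in> {1..n} \<Longrightarrow> \<omega> k \<in> I" "\<And>i y. i \<in> I \<Longrightarrow> y \<in> S \<Longrightarrow> f i y \<in> S" "x \<in> S"
  shows "random_iterate f \<omega> n x \<in> S"
  using assms(1)
proof (induction n)
  case (Suc n)
  have "random_iterate f \<omega> n x \<in> S" by (rule Suc.IH) (use Suc.prems in auto)
  moreover have "\<omega> (Suc n) \<in> I" using Suc.prems by auto
  ultimately show ?case using assms(2) by simp
qed (use assms in simp)

text \<open>The newest symbol acts last, so integrating it out with the earlier ones fixed replaces
  the observable by its average over the maps. After \<open>n\<close> such steps no randomness is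
  left.\<close>

lemma integral_random_iterate:
  assumes p0: "\<And>i. i \<in> {1..m} \<Longrightarrow> p i \<ge> 0" and p1: "(\<Sum>i=1..m. p i) = 1"
    and f: "\<And>i y. i \<in> {1..m} \<Longrightarrow> y \<in> S \<Longrightarrow> f i y \<in> S" and x: "x \<in> S"
    and bound: "\<And>y. y \<in> S \<Longrightarrow> \<bar>\<phi> y\<bar> \<le> B"
  shows "integrable (bernoulli_measure m p) (\<lambda>\<omega>. \<phi> (random_iterate f \<omega> n x))"
    and "(\<integral>\<omega>. \<phi> (random_iterate f \<omega> n x) \<partial>bernoulli_measure m p) = (transfer m p f ^^ n) \<phi> x"
proof -
  let ?M = "\<lambda>_::nat. point_measure {1..m} (\<lambda>i. ennreal (p i))"
  have "prob_space (?M n)" for n :: nat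
  proof
    show "emeasure (?M n) (space (?M n)) = 1"
      using p0 p1 sum_ennreal[of "{1..m}" p]
      by (simp add: emeasure_point_measure_finite space_point_measure)
  qed
  then interpret product_prob_space ?M "{1..}"
    by (simp add: product_prob_space_def product_prob_space_axioms_def product_sigma_finite_def
        prob_space_imp_sigma_finite)
  \<comment> \<open>Each symbol takes finitely many values, so the iterate is measurable even into
    the discrete sigma-field on the reals; hence every \<open>\<phi>\<close> gives a measurable
    integrand.\<close>
  have meas: "(\<lambda>\<omega>. random_iterate f \<omega> n x) \<in> measurable (PiM J ?M) (count_space UNIV)"
    if "{1..n} \<subseteq> J" for n J
    using that
  proof (induction n)
    case (Suc n)
    then have "{1..n} \<subseteq> J" and J: "Suc n \<in> J" by auto
    from this(1) have IH: "(\<lambda>\<omega>. random_iterate f \<omega> n x) \<in> measurable (PiM J ?M) (count_space UNIV)"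
      by (rule Suc.IH)
    have "(\<lambda>\<omega>. \<omega> (Suc n)) \<in> measurable (PiM J ?M) (?M (Suc n))"
      using J by (rule measurable_component_singleton)
    then have "(\<lambda>\<omega>. \<omega> (Suc n)) \<in> measurable (PiM J ?M) (count_space {1..m})"
      by (simp add: measurable_def space_point_measure sets_point_measure)
    then have "(\<lambda>\<omega>. f (\<omega> (Suc n)) (random_iterate f \<omega> n x)) \<in> measurable (PiM J ?M) (count_space UNIV)"
      by (rule measurable_compose_countable'[where f="\<lambda>i \<omega>. f i (random_iterate f \<omega> n x)", rotated])
         (rule countable_finite, simp, rule measurable_compose[OF IH], simp)
    then show ?case by simp
  qed simp
  have int: "integrable (PiM J ?M) (\<lambda>\<omega>. \<phi> (random_iterate f \<omega> n x))"
    if J: "{1..n} \<subseteq> J" and bound: "\<And>y. y \<in> S \<Longrightarrow> \<bar>\<phi> y\<bar> \<le> B" for n J \<phi> and B :: real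
  proof (rule finite_measure.integrable_const_bound[where B=B])
    show "finite_measure (PiM J ?M)"
      using prob_space_PiM[of J ?M] M.prob_space_axioms prob_space.finite_measure by blast
    show "AE \<omega> in PiM J ?M. norm (\<phi> (random_iterate f \<omega> n x)) \<le> B"
    proof (rule AE_I2)
      fix \<omega> assume "\<omega> \<in> space (PiM J ?M)"
      then have "\<And>k. k \<in> {1..n} \<Longrightarrow> \<omega> k \<in> {1..m}"
        using J by (auto simp: space_PiM PiE_def Pi_def space_point_measure)
      then show "norm (\<phi> (random_iterate f \<omega> n x)) \<le> B"
        using random_iterate_in[of n \<omega> "{1..m}" S f x] f x bound by simp
    qed
    show "(\<lambda>\<omega>. \<phi> (random_iterate f \<omega> n x)) \<in> borel_measurable (PiM J ?M)"
      by (rule measurable_compose[OF meas[OF J]]) simp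
  qed
  show "integrable (bernoulli_measure m p) (\<lambda>\<omega>. \<phi> (random_iterate f \<omega> n x))"
    unfolding bernoulli_measure_def by (rule int) (use bound in auto)
  \<comment> \<open>Fubini is applied on finite products. The observable must vary in the induction,
    since the step passes from \<open>\<phi>\<close> to \<open>transfer m p f \<phi>\<close>; an
    average obeys the same bound \<open>B\<close>.\<close>
  have fin: "(\<integral>\<omega>. \<phi> (random_iterate f \<omega> n x) \<partial>PiM {1..n} ?M) = (transfer m p f ^^ n) \<phi> x"
    using bound
  proof (induction n arbitrary: \<phi>)
    case 0
    interpret P0: prob_space "PiM {1..0} ?M"
      by (rule prob_space_PiM) (rule M.prob_space_axioms)
    show ?case using P0.prob_space by simp
  next
    case (Suc n)
    have ins: "{1..Suc n} = insert (Suc n) {1..n}" by auto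
    have bound': "\<bar>transfer m p f \<phi> y\<bar> \<le> B" if "y \<in> S" for y
    proof -
      have "\<bar>transfer m p f \<phi> y\<bar> \<le> (\<Sum>i=1..m. \<bar>p i * \<phi> (f i y)\<bar>)"
        unfolding transfer_def by (rule sum_abs)
      also have "\<dots> \<le> (\<Sum>i=1..m. p i * B)"
        by (rule sum_mono) (use p0 f Suc.prems that in \<open>auto simp: abs_mult intro!: mult_left_mono\<close>)
      finally show ?thesis using p1 by (simp add: sum_distrib_right[symmetric])
    qed
    have upd: "random_iterate f (fun_upd \<omega> (Suc n) i) n = random_iterate f \<omega> n" for \<omega> i
      using random_iterate_restrict[of n "{1..n}" f \<omega>]
        random_iterate_restrict[of n "{1..n}" f "fun_upd \<omega> (Suc n) i"]
      by (simp add: restrict_def cong: if_cong)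
    have "(\<integral>\<omega>. \<phi> (random_iterate f \<omega> (Suc n) x) \<partial>PiM {1..Suc n} ?M) =
        (\<integral>\<omega>. (\<integral>i. \<phi> (random_iterate f (fun_upd \<omega> (Suc n) i) (Suc n) x) \<partial>?M (Suc n)) \<partial>PiM {1..n} ?M)"
      unfolding ins
    proof (rule product_integral_insert)
      show "integrable (PiM (insert (Suc n) {1..n}) ?M) (\<lambda>\<omega>. \<phi> (random_iterate f \<omega> (Suc n) x))"
        by (rule int) (auto intro: Suc.prems)
    qed auto
    also have "\<dots> = (\<integral>\<omega>. transfer m p f \<phi> (random_iterate f \<omega> n x) \<partial>PiM {1..n} ?M)"
    proof (rule Bochner_Integration.integral_cong[OF refl])
      fix \<omega>
      have "(\<integral>i. \<phi> (f i (random_iterate f \<omega> n x)) \<partial>?M (Suc n)) =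
          (\<Sum>i\<in>{1..m}. p i *\<^sub>R \<phi> (f i (random_iterate f \<omega> n x)))"
        by (rule lebesgue_integral_point_measure_finite) (use p0 in auto)
      then show "(\<integral>i. \<phi> (random_iterate f (fun_upd \<omega> (Suc n) i) (Suc n) x) \<partial>?M (Suc n)) =
          transfer m p f \<phi> (random_iterate f \<omega> n x)"
        by (simp add: upd transfer_def)
    qed
    also have "\<dots> = (transfer m p f ^^ Suc n) \<phi> x"
      using Suc.IH[OF bound'] by (simp add: funpow_swap1)
    finally show ?case .
  qed
  \<comment> \<open>The finite product is the image of the infinite one under restriction, and the
    iterate reads only coordinates 1 to \<open>n\<close>.\<close>
  have "(\<integral>\<omega>. \<phi> (random_iterate f \<omega> n x) \<partial>PiM {1..n} ?M) =
      (\<integral>\<omega>. \<phi> (random_iterate f \<omega> n x)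
        \<partial>distr (PiM {1..} ?M) (PiM {1..n} ?M) (\<lambda>\<omega>. restrict \<omega> {1..n}))"
    by (subst distr_PiM_restrict_finite[of "{1..n}"]) auto
  also have "\<dots> = (\<integral>\<omega>. \<phi> (random_iterate f (restrict \<omega> {1..n}) n x) \<partial>PiM {1..} ?M)"
  proof (rule integral_distr)
    show "(\<lambda>\<omega>. \<phi> (random_iterate f \<omega> n x)) \<in> borel_measurable (PiM {1..n} ?M)"
      by (rule measurable_compose[OF meas[OF order_refl]]) simp
  qed (auto intro: measurable_restrict_subset)
  finally show "(\<integral>\<omega>. \<phi> (random_iterate f \<omega> n x) \<partial>bernoulli_measure m p) = (transfer m p f ^^ n) \<phi> x"
    using fin by (simp add: bernoulli_measure_def random_iterate_restrict)
qed

section \<open>Independent coupling killed at the crossing\<close>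

text \<open>The indices \<open>i\<close> and \<open>j\<close> are drawn independently, and a pair
  that meets or changes order is killed. The \<open>n\<close>-th iterate on the constant 1 is thus
  the probability that an ordered pair stays strictly ordered through the first \<open>n\<close>
  steps.\<close>

definition coupled_transfer ::
  "nat \<Rightarrow> (nat \<Rightarrow> real) \<Rightarrow> (nat \<Rightarrow> real \<Rightarrow> real) \<Rightarrow> (real \<Rightarrow> real \<Rightarrow> real) \<Rightarrow> real \<Rightarrow> real \<Rightarrow> real" where
  "coupled_transfer m p f V x y =
     (\<Sum>i=1..m. \<Sum>j=1..m. p i * p j * (if f i x < f j y then V (f i x) (f j y) else 0))"

text \<open>These properties live on the open interval and are invariant under the reflection of x
  to 1 - x, so every statement proved here about one end is available at the other. The Lyapunov
  exponents enter separately, through drift inequalities.\<close>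

locale interval_maps =
  fixes m :: nat and p :: "nat \<Rightarrow> real" and f :: "nat \<Rightarrow> real \<Rightarrow> real"
  assumes p_pos: "i \<in> {1..m} \<Longrightarrow> p i > 0"
    and p_sum: "(\<Sum>i=1..m. p i) = 1"
    and maps: "i \<in> {1..m} \<Longrightarrow> x \<in> {0<..<1} \<Longrightarrow> f i x \<in> {0<..<1}"
    and f_mono: "i \<in> {1..m} \<Longrightarrow> x \<in> {0<..<1} \<Longrightarrow> y \<in> {0<..<1} \<Longrightarrow> x < y \<Longrightarrow> f i x < f i y"
    and f_cont: "i \<in> {1..m} \<Longrightarrow> continuous_on {0<..<1} (f i)"
    and below_above: "x \<in> {0<..<1} \<Longrightarrow> \<exists>i\<in>{1..m}. \<exists>j\<in>{1..m}. f i x < x \<and> x < f j x"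
begin

abbreviation P where "P \<equiv> transfer m p f"
abbreviation Q where "Q \<equiv> coupled_transfer m p f"

lemma p_nonneg: "i \<in> {1..m} \<Longrightarrow> p i \<ge> 0"
  using p_pos[of i] by simp

lemma sum_p_const: "(\<Sum>i=1..m. p i * c) = c"
  using p_sum by (simp add: sum_distrib_right[symmetric])

lemma sum_pp_const: "(\<Sum>i=1..m. \<Sum>j=1..m. p i * p j * c) = c"
proof -
  have "(\<Sum>i=1..m. \<Sum>j=1..m. p i * p j * c) = (\<Sum>i=1..m. p i * (\<Sum>j=1..m. p j * c))"
    by (simp add: sum_distrib_left mult.assoc)
  also have "\<dots> = c" by (simp only: sum_p_const)
  finally show ?thesis .
qed

lemma sum_pp_product:
  "(\<Sum>i=1..m. \<Sum>j=1..m. p i * p j * (g (f i x) * h (f j y))) = P g x * P h y"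
  unfolding transfer_def by (simp add: sum_product algebra_simps)

lemma sum_pp_add:
  "(\<Sum>i=1..m. \<Sum>j=1..m. p i * p j * (g (f i x) + h (f j y))) = P g x + P h y"
proof -
  have "(\<Sum>i=1..m. \<Sum>j=1..m. p i * p j * (g (f i x) + h (f j y))) =
     (\<Sum>i=1..m. \<Sum>j=1..m. p i * p j * (g (f i x) * 1)) + (\<Sum>i=1..m. \<Sum>j=1..m. p i * p j * (1 * h (f j y)))"
    by (simp add: algebra_simps sum.distrib)
  also have "\<dots> = P g x * P (\<lambda>_. 1) y + P (\<lambda>_. 1) x * P h y"
    using sum_pp_product[of g x "\<lambda>_. 1" y] sum_pp_product[of "\<lambda>_. 1" x h y] by simp
  also have "\<dots> = P g x + P h y"
    using sum_p_const[of 1] by (simp add: transfer_def)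
  finally show ?thesis .
qed

lemma sum_pp_mono:
  assumes "\<And>i j. i \<in> {1..m} \<Longrightarrow> j \<in> {1..m} \<Longrightarrow> g i j \<le> h i j"
  shows "(\<Sum>i=1..m. \<Sum>j=1..m. p i * p j * g i j) \<le> (\<Sum>i=1..m. \<Sum>j=1..m. p i * p j * h i j)"
  by (intro sum_mono mult_left_mono mult_nonneg_nonneg p_nonneg assms)

lemma P_monotone:
  assumes g: "\<And>x y. x \<in> {0<..<1} \<Longrightarrow> y \<in> {0<..<1} \<Longrightarrow> x < y \<Longrightarrow> g x \<le> g y"
    and "x \<in> {0<..<1}" "y \<in> {0<..<1}" "x < y"
  shows "(P ^^ n) g x \<le> (P ^^ n) g y"
  using assms(2-4)
proof (induction n arbitrary: x y)
  case (Suc n)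
  show ?case
    unfolding funpow.simps comp_def transfer_def[of m p f "(P ^^ n) g"]
    by (intro sum_mono mult_left_mono p_nonneg Suc maps f_mono)
qed (use g in simp)

text \<open>The independent coupling is run until the two copies cross: afterwards monotonicity of \<open>g\<close>
  gives the difference a favourable sign, so that pairs in the wrong order may be discarded.\<close>

lemma monotone_difference_bound:
  assumes g: "\<And>x y. x \<in> {0<..<1} \<Longrightarrow> y \<in> {0<..<1} \<Longrightarrow> x < y \<Longrightarrow> g x \<le> g y"
    and V: "\<And>x y. x \<in> {0<..<1} \<Longrightarrow> y \<in> {0<..<1} \<Longrightarrow> x < y \<Longrightarrow> g y - g x \<le> V x y"
    and QV: "\<And>x y. x \<in> {0<..<1} \<Longrightarrow> y \<in> {0<..<1} \<Longrightarrow> x < y \<Longrightarrow> Q V x y \<le> q * V x y"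
    and "q \<ge> 0" and xy: "x \<in> {0<..<1}" "y \<in> {0<..<1}" "x < y"
  shows "(P ^^ n) g y - (P ^^ n) g x \<le> q ^ n * V x y"
  using xy
proof (induction n arbitrary: x y)
  case (Suc n)
  let ?g = "(P ^^ n) g"
  \<comment> \<open>A sum of one function of each point depends on the marginals only, so the index
    at \<open>x\<close> may be decoupled from the index at \<open>y\<close>.\<close>
  have "P ?g y - P ?g x = P (\<lambda>z. - ?g z) x + P ?g y"
    by (simp add: transfer_def sum_negf)
  also have "\<dots> = (\<Sum>i=1..m. \<Sum>j=1..m. p i * p j * (- ?g (f i x) + ?g (f j y)))"
    by (rule sum_pp_add[symmetric])
  also have "\<dots> \<le> (\<Sum>i=1..m. \<Sum>j=1..m. p i * p j *
      (q ^ n * (if f i x < f j y then V (f i x) (f j y) else 0)))"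
  proof (rule sum_pp_mono)
    fix i j assume ij: "i \<in> {1..m}" "j \<in> {1..m}"
    have in01: "f i x \<in> {0<..<1}" "f j y \<in> {0<..<1}"
      using maps ij Suc.prems by auto
    show "- ?g (f i x) + ?g (f j y) \<le> q ^ n * (if f i x < f j y then V (f i x) (f j y) else 0)"
    proof (cases "f i x < f j y")
      case True
      then show ?thesis using Suc.IH[OF in01] by simp
    next
      case False
      then have "?g (f j y) \<le> ?g (f i x)"
        using P_monotone[OF g in01(2,1)] by (cases "f j y = f i x") auto
      with False show ?thesis by simp
    qed
  qed
  also have "\<dots> = q ^ n * Q V x y"
    unfolding coupled_transfer_def sum_distrib_left
    by (intro sum.cong refl) (simp add: algebra_simps)
  also have "\<dots> \<le> q ^ n * (q * V x y)"
    using QV Suc.prems \<open>q \<ge> 0\<close> by (intro mult_left_mono) auto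
  finally show ?case by (simp add: algebra_simps)
qed (use V in simp)

text \<open>Think of \<open>U\<close> and \<open>L\<close> as indicators that cannot both be 1 on an
  ordered pair. If both are 1 at time \<open>k\<close>, the pair has been killed by then, and
  independence makes the probability of this a product. Taking both to be zero also yields the
  trivial bound 1.\<close>

lemma coupled_survival_bound:
  assumes "\<And>x. U x \<in> {0..1}" "\<And>y. L y \<in> {0..1}"
    and start: "\<And>x y. x \<in> {0<..<1} \<Longrightarrow> y \<in> {0<..<1} \<Longrightarrow> x < y \<Longrightarrow> U x = 0 \<or> L y = 0"
    and xy: "x \<in> {0<..<1}" "y \<in> {0<..<1}" "x < y"
  shows "(Q ^^ k) (\<lambda>_ _. 1) x y \<le> 1 - (P ^^ k) U x * (P ^^ k) L y"
  using xy
proof (induction k arbitrary: x y)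
  case (Suc k)
  let ?U = "(P ^^ k) U" and ?L = "(P ^^ k) L"
  have P01: "(P ^^ k) h z \<in> {0..1}" if "\<And>x. h x \<in> {0..1}" for h :: "real \<Rightarrow> real" and z
  proof (induction k arbitrary: z)
    case (Suc k)
    have "0 \<le> P ((P ^^ k) h) z"
      unfolding transfer_def[of m p f "(P ^^ k) h"] using Suc by (intro sum_nonneg mult_nonneg_nonneg p_nonneg) auto
    moreover have "P ((P ^^ k) h) z \<le> (\<Sum>i=1..m. p i * 1)"
      unfolding transfer_def[of m p f "(P ^^ k) h"] using Suc by (intro sum_mono mult_left_mono p_nonneg) auto
    ultimately show ?case using sum_p_const[of 1] by simp
  qed (use that in simp)
  have "Q ((Q ^^ k) (\<lambda>_ _. 1)) x y \<le> (\<Sum>i=1..m. \<Sum>j=1..m. p i * p j * (1 - ?U (f i x) * ?L (f j y)))"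
    unfolding coupled_transfer_def[of m p f "(Q ^^ k) (\<lambda>_ _. 1)"]
  proof (rule sum_pp_mono)
    fix i j assume ij: "i \<in> {1..m}" "j \<in> {1..m}"
    have in01: "f i x \<in> {0<..<1}" "f j y \<in> {0<..<1}"
      using maps ij Suc.prems by auto
    have "?U (f i x) * ?L (f j y) \<le> 1"
      using P01[of U] P01[of L] assms(1,2) by (intro mult_le_one) auto
    then show "(if f i x < f j y then (Q ^^ k) (\<lambda>_ _. 1) (f i x) (f j y) else 0)
        \<le> 1 - ?U (f i x) * ?L (f j y)"
      using Suc.IH[OF in01] by simp
  qed
  also have "\<dots> = (\<Sum>i=1..m. \<Sum>j=1..m. p i * p j * 1)
      - (\<Sum>i=1..m. \<Sum>j=1..m. p i * p j * (?U (f i x) * ?L (f j y)))"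
    by (simp add: sum_subtractf algebra_simps)
  also have "\<dots> = 1 - P ?U x * P ?L y"
    by (simp only: sum_pp_const sum_pp_product)
  finally show ?case by simp
qed (use start in fastforce)

section \<open>Uniform crossing probability on compact sets\<close>

text \<open>The sum of the positive parts of all displacements is continuous and positive, hence
  bounded below on a compact interval; some index attains at least the share 1/m of it.\<close>

lemma uniform_ascent:
  assumes "0 < a" "a \<le> c" "c < 1"
  obtains \<delta> where "\<delta> > 0" "\<And>x. x \<in> {a..c} \<Longrightarrow> \<exists>j\<in>{1..m}. x + \<delta> \<le> f j x"
proof -
  let ?h = "\<lambda>x. \<Sum>j=1..m. max 0 (f j x - x)"
  have "continuous_on {a..c} ?h"
  proof (intro continuous_intros)
    fix j assume "j \<in> {1..m}"
    then show "continuous_on {a..c} (f j)"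
      by (rule continuous_on_subset[OF f_cont]) (use assms in auto)
  qed
  then obtain z where z: "z \<in> {a..c}" "\<And>x. x \<in> {a..c} \<Longrightarrow> ?h z \<le> ?h x"
    using continuous_attains_inf[of "{a..c}" ?h] assms by auto
  have m: "m > 0" using p_sum by (cases m) auto
  have "z \<in> {0<..<1}" using z assms by auto
  then obtain j where "j \<in> {1..m}" "z < f j z" using below_above by blast
  then have "?h z > 0"
    by (intro sum_pos2[where i=j]) auto
  show thesis
  proof
    show "?h z / m > 0" using \<open>?h z > 0\<close> m by simp
    fix x assume "x \<in> {a..c}"
    then have *: "?h z \<le> ?h x" by (rule z)
    show "\<exists>j\<in>{1..m}. x + ?h z / m \<le> f j x"
    proof (rule ccontr)
      assume "\<not> ?thesis"
      then have lt: "f j x - x < ?h z / m" if "j \<in> {1..m}" for j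
        using that by force
      have "?h x < (\<Sum>j=1..m. ?h z / m)"
        by (rule sum_strict_mono) (use lt m \<open>?h z / m > 0\<close> in auto)
      with * m show False by simp
    qed
  qed
qed

lemma hits_upper_part:
  assumes "0 < a" "0 < c" "c < 1"
  shows "\<exists>N. \<forall>k\<ge>N. \<exists>\<epsilon>>0. \<forall>x\<in>{a..<1}. \<epsilon> \<le> (P ^^ k) (\<lambda>z. if c \<le> z then 1 else 0) x"
proof -
  \<comment> \<open>The minimum makes \<open>{b..c}\<close> a nonempty compact interval that
    contains every starting point not yet above \<open>c\<close>, even when
    \<open>a > c\<close>.\<close>
  define b where "b = min a c"
  have b: "0 < b" "b \<le> a" "b \<le> c" using assms by (auto simp: b_def)
  let ?I = "\<lambda>z. if c \<le> z then 1 else (0::real)"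
  obtain \<delta> where \<delta>: "\<delta> > 0" "\<And>x. x \<in> {b..c} \<Longrightarrow> \<exists>j\<in>{1..m}. x + \<delta> \<le> f j x"
    using uniform_ascent[of b c] b assms by blast
  define \<mu> where "\<mu> = Min (p ` {1..m})"
  have m: "m > 0" using p_sum by (cases m) auto
  then have "\<mu> \<in> p ` {1..m}" unfolding \<mu>_def by (intro Min_in) auto
  then have \<mu>: "\<mu> > 0" using p_pos by auto
  have \<mu>_le: "\<mu> \<le> p i" if "i \<in> {1..m}" for i using that by (auto simp: \<mu>_def)
  have nonneg: "(P ^^ k) ?I x \<ge> 0" for k x
  proof (induction k arbitrary: x)
    case (Suc k)
    then show ?case by (auto simp: transfer_def intro!: sum_nonneg mult_nonneg_nonneg p_nonneg)
  qed simp
  \<comment> \<open>The condition says that \<open>k\<close> remaining steps of gain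
    \<open>\<delta>\<close> suffice to reach \<open>c\<close>. Each step follows one suitable index,
    whose probability is at least \<open>\<mu>\<close>.\<close>
  have climb: "\<mu> ^ k \<le> (P ^^ k) ?I x" if "x \<in> {b..<1}" "c \<le> x + k * \<delta>" for k x
    using that
  proof (induction k arbitrary: x)
    case (Suc k)
    then have x: "x \<in> {0<..<1}" using b by auto
    obtain j where j: "j \<in> {1..m}" "x < f j x" "c \<le> f j x + k * \<delta>"
    proof (cases "x \<le> c")
      case True
      with \<delta>(2)[of x] Suc.prems obtain j where "j \<in> {1..m}" "x + \<delta> \<le> f j x" by auto
      then show thesis using Suc.prems \<delta>(1) by (intro that[of j]) (auto simp: algebra_simps)
    next
      case False
      \<comment> \<open>Above \<open>c\<close> the gain may be arbitrarily small, but any upward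
        move keeps the point there; this is what gives the estimate at all later times.\<close>
      obtain j where "j \<in> {1..m}" "x < f j x" using below_above x by blast
      moreover have "0 \<le> k * \<delta>" using \<delta>(1) by simp
      ultimately show thesis using False by (intro that[of j]) auto
    qed
    have "\<mu> ^ Suc k \<le> p j * (P ^^ k) ?I (f j x)"
      using Suc.IH[of "f j x"] j maps[OF j(1) x] Suc.prems \<mu> \<mu>_le[OF j(1)] p_nonneg[OF j(1)]
      by (auto intro!: mult_mono)
    also have "\<dots> \<le> P ((P ^^ k) ?I) x"
      unfolding transfer_def[of m p f "(P ^^ k) ?I"]
      by (rule member_le_sum[OF j(1)]) (use nonneg p_nonneg in \<open>auto intro!: mult_nonneg_nonneg\<close>)
    finally show ?case by simp
  qed simp
  obtain N :: nat where N: "c / \<delta> \<le> N" using real_arch_simple by blast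
  show ?thesis
  proof (intro exI[of _ N] allI impI)
    fix k assume "k \<ge> N"
    then have "c \<le> k * \<delta>"
      using N \<delta>(1) by (simp add: divide_simps) (smt (verit) mult_right_mono of_nat_mono)
    then show "\<exists>\<epsilon>>0. \<forall>x\<in>{a..<1}. \<epsilon> \<le> (P ^^ k) ?I x"
      using climb[of _ k] \<mu> b by (intro exI[of _ "\<mu> ^ k"]) force
  qed
qed

text \<open>Conjugation by the reflection exchanges the endpoints and the two inequalities of
  \<open>below_above\<close>, so the witnesses \<open>i\<close> and \<open>j\<close> trade
  places.\<close>

lemma reflected: "interval_maps m p (\<lambda>i x. 1 - f i (1 - x))"
proof
  fix i x assume "i \<in> {1..m}" "x \<in> {0<..<1::real}"
  then show "1 - f i (1 - x) \<in> {0<..<1}" using maps[of i "1 - x"] by auto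
next
  fix i x y assume "i \<in> {1..m}" "x \<in> {0<..<1::real}" "y \<in> {0<..<1}" "x < y"
  then show "1 - f i (1 - x) < 1 - f i (1 - y)" using f_mono[of i "1 - y" "1 - x"] by auto
next
  fix i assume "i \<in> {1..m}"
  then show "continuous_on {0<..<1} (\<lambda>x. 1 - f i (1 - x))"
    by (intro continuous_intros continuous_on_compose2[OF f_cont]) auto
next
  fix x assume "x \<in> {0<..<1::real}"
  then obtain i j where "i \<in> {1..m}" "j \<in> {1..m}" "f i (1 - x) < 1 - x" "1 - x < f j (1 - x)"
    using below_above[of "1 - x"] by auto
  then show "\<exists>i\<in>{1..m}. \<exists>j\<in>{1..m}. 1 - f i (1 - x) < x \<and> x < 1 - f j (1 - x)"
    by (intro bexI[of _ j] bexI[of _ i]) auto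
qed (use p_pos p_sum in auto)

lemma transfer_reflected:
  "(transfer m p (\<lambda>i x. 1 - f i (1 - x)) ^^ k) g x = (P ^^ k) (\<lambda>z. g (1 - z)) (1 - x)"
  by (induction k arbitrary: x) (simp_all add: transfer_def)

lemma hits_lower_part:
  assumes "b < 1" "0 < c" "c < 1"
  shows "\<exists>N. \<forall>k\<ge>N. \<exists>\<epsilon>>0. \<forall>x\<in>{0<..b}. \<epsilon> \<le> (P ^^ k) (\<lambda>z. if z \<le> c then 1 else 0) x"
proof -
  interpret R: interval_maps m p "\<lambda>i x. 1 - f i (1 - x)" by (rule reflected)
  have eq: "(\<lambda>z. if 1 - c \<le> 1 - z then 1 else 0) = (\<lambda>z. if z \<le> c then 1 else (0::real))"
    by auto
  obtain N where N: "\<And>k. k \<ge> N \<Longrightarrow> \<exists>\<epsilon>>0. \<forall>x\<in>{1 - b..<1}. \<epsilon> \<le> (P ^^ k) (\<lambda>z. if z \<le> c then 1 else 0) (1 - x)"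
    using R.hits_upper_part[of "1 - b" "1 - c"] assms unfolding transfer_reflected eq by auto
  show ?thesis
  proof (intro exI[of _ N] allI impI)
    fix k assume "k \<ge> N"
    then obtain \<epsilon> where "\<epsilon> > 0" "\<And>x. x\<in>{1 - b..<1} \<Longrightarrow> \<epsilon> \<le> (P ^^ k) (\<lambda>z. if z \<le> c then 1 else 0) (1 - x)"
      using N by blast
    from this(2)[of "1 - _"] this(1)
    show "\<exists>\<epsilon>>0. \<forall>x\<in>{0<..b}. \<epsilon> \<le> (P ^^ k) (\<lambda>z. if z \<le> c then 1 else 0) x"
      by (intro exI[of _ \<epsilon>]) auto
  qed
qed

lemma coupled_survival_compact:
  assumes "0 < a" "b < 1"
  obtains N \<epsilon> where "N > 0" "\<epsilon> > 0" "\<epsilon> \<le> 1"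
    "\<And>x y. x \<in> {a..<1} \<Longrightarrow> y \<in> {0<..b} \<Longrightarrow> x < y \<Longrightarrow> (Q ^^ N) (\<lambda>_ _. 1) x y \<le> 1 - \<epsilon>"
proof -
  let ?U = "\<lambda>z. if 1/2 \<le> z then 1 else (0::real)" and ?L = "\<lambda>z. if z \<le> 1/2 then 1 else (0::real)"
  obtain N1 where N1: "\<And>k. k \<ge> N1 \<Longrightarrow> \<exists>\<epsilon>>0. \<forall>x\<in>{a..<1}. \<epsilon> \<le> (P ^^ k) ?U x"
    using hits_upper_part[of a "1/2"] assms by auto
  obtain N2 where N2: "\<And>k. k \<ge> N2 \<Longrightarrow> \<exists>\<epsilon>>0. \<forall>y\<in>{0<..b}. \<epsilon> \<le> (P ^^ k) ?L y"
    using hits_lower_part[of b "1/2"] assms by auto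
  \<comment> \<open>One common time serves both copies. The successor makes \<open>N\<close>
    positive, so that sums over \<open>k < N\<close> contain the term \<open>k = 0\<close>.\<close>
  define N where "N = Suc (max N1 N2)"
  have N: "N > 0" "N1 \<le> N" "N2 \<le> N" by (auto simp: N_def)
  obtain \<epsilon>1 where \<epsilon>1: "\<epsilon>1 > 0" "\<And>x. x\<in>{a..<1} \<Longrightarrow> \<epsilon>1 \<le> (P ^^ N) ?U x"
    using N1[OF N(2)] by blast
  obtain \<epsilon>2 where \<epsilon>2: "\<epsilon>2 > 0" "\<And>y. y\<in>{0<..b} \<Longrightarrow> \<epsilon>2 \<le> (P ^^ N) ?L y"
    using N2[OF N(3)] by blast
  show thesis
  proof (rule that[of N "min 1 (\<epsilon>1 * \<epsilon>2)"])
    fix x y assume xy: "x \<in> {a..<1}" "y \<in> {0<..b}" "x < y"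
    have "(Q ^^ N) (\<lambda>_ _. 1) x y \<le> 1 - (P ^^ N) ?U x * (P ^^ N) ?L y"
      by (rule coupled_survival_bound) (use xy assms in auto)
    moreover have "\<epsilon>1 * \<epsilon>2 \<le> (P ^^ N) ?U x * (P ^^ N) ?L y"
      using \<epsilon>1 \<epsilon>2 xy by (intro mult_mono) (auto intro: less_imp_le order_trans)
    ultimately show "(Q ^^ N) (\<lambda>_ _. 1) x y \<le> 1 - min 1 (\<epsilon>1 * \<epsilon>2)" by linarith
  qed (use \<epsilon>1 \<epsilon>2 N in auto)
qed

end

section \<open>From drift and crossing to a one-step contraction\<close>

context interval_maps begin

text \<open>This is a Harris-type argument for the killed pair process: \<open>W\<close> pays for
  excursions towards the endpoints, and a bounded function \<open>S\<close> of expected survival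
  pays in the compact part. A small multiple of \<open>W\<close> added to \<open>S\<close> decreases
  in both regions.\<close>

lemma exponential_from_drift:
  assumes W0: "\<And>x. x \<in> {0<..<1} \<Longrightarrow> W0 x \<ge> 0" "\<And>x. x \<in> {0<..<1} \<Longrightarrow> P W0 x \<le> \<rho>0 * W0 x + K0"
      "\<And>R. \<exists>a>0. \<forall>x\<in>{0<..<1}. W0 x \<le> R \<longrightarrow> a \<le> x" "\<rho>0 < 1"
    and W1: "\<And>x. x \<in> {0<..<1} \<Longrightarrow> W1 x \<ge> 0" "\<And>x. x \<in> {0<..<1} \<Longrightarrow> P W1 x \<le> \<rho>1 * W1 x + K1"
      "\<And>R. \<exists>b<1. \<forall>x\<in>{0<..<1}. W1 x \<le> R \<longrightarrow> x \<le> b" "\<rho>1 < 1"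
  obtains V q where "q \<in> {0<..<1}"
    "\<And>x y. x \<in> {0<..<1} \<Longrightarrow> y \<in> {0<..<1} \<Longrightarrow> x < y \<Longrightarrow> 1 \<le> V x y"
    "\<And>x y. x \<in> {0<..<1} \<Longrightarrow> y \<in> {0<..<1} \<Longrightarrow> x < y \<Longrightarrow> Q V x y \<le> q * V x y"
proof -
  define \<rho> where "\<rho> = max 0 (max \<rho>0 \<rho>1)"
  define K where "K = \<bar>K0\<bar> + \<bar>K1\<bar> + 1"
  define W where "W x y = W0 x + W1 y" for x y
  have \<rho>: "0 \<le> \<rho>" "\<rho> < 1" "\<rho>0 \<le> \<rho>" "\<rho>1 \<le> \<rho>" using W0(4) W1(4) by (auto simp: \<rho>_def)
  have K: "K > 0" by (simp add: K_def)
  have W_nonneg: "W x y \<ge> 0" if "x \<in> {0<..<1}" "y \<in> {0<..<1}" for x y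
    using W0(1) W1(1) that by (simp add: W_def)
  have QW: "Q W x y \<le> \<rho> * W x y + K" if "x \<in> {0<..<1}" "y \<in> {0<..<1}" for x y
  proof -
    \<comment> \<open>Both weights are nonnegative, so restoring the killed pairs only enlarges the
      sum, which then splits into the two one-point drifts.\<close>
    have "Q W x y \<le> (\<Sum>i=1..m. \<Sum>j=1..m. p i * p j * (W0 (f i x) + W1 (f j y)))"
      unfolding coupled_transfer_def
      by (rule sum_pp_mono) (use that maps W0(1) W1(1) in \<open>auto simp: W_def\<close>)
    also have "\<dots> = P W0 x + P W1 y" by (rule sum_pp_add)
    also have "\<dots> \<le> (\<rho>0 * W0 x + K0) + (\<rho>1 * W1 y + K1)"
      using W0(2) W1(2) that by (intro add_mono) auto
    also have "\<dots> \<le> (\<rho> * W0 x + K0) + (\<rho> * W1 y + K1)"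
      using W0(1) W1(1) that \<rho> by (intro add_mono mult_right_mono order_refl) auto
    finally show ?thesis by (simp add: W_def K_def algebra_simps)
  qed
  \<comment> \<open>Where \<open>W > R\<close>, one quarter of \<open>(1 - \<rho>) * W\<close>
    absorbs \<open>K\<close>. A second quarter will absorb \<open>(1 - q) * S\<close>, for which
    \<open>W \<ge> 1\<close> is also needed; the factor \<open>(1 + \<rho>) / 2\<close>
    remains.\<close>
  define R where "R = 1 + 4 * K / (1 - \<rho>)"
  have R: "R \<ge> 1" using K \<rho> by (simp add: R_def)
  obtain a where a: "a > 0" "\<And>x. x \<in> {0<..<1} \<Longrightarrow> W0 x \<le> R \<Longrightarrow> a \<le> x" using W0(3) by blast
  obtain b where b: "b < 1" "\<And>x. x \<in> {0<..<1} \<Longrightarrow> W1 x \<le> R \<Longrightarrow> x \<le> b" using W1(3) by blast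
  obtain N \<epsilon> where N: "N > 0" "\<epsilon> > 0" "\<epsilon> \<le> 1" and
    cross: "\<And>x y. x \<in> {a..<1} \<Longrightarrow> y \<in> {0<..b} \<Longrightarrow> x < y \<Longrightarrow> (Q ^^ N) (\<lambda>_ _. 1) x y \<le> 1 - \<epsilon>"
    using coupled_survival_compact[OF a(1) b(1)] by metis
  define u where "u k x y = (Q ^^ k) (\<lambda>_ _. 1) x y" for k x y
  have u_le: "u k x y \<le> 1" if "x \<in> {0<..<1}" "y \<in> {0<..<1}" "x < y" for k x y
  proof -
    have "P (\<lambda>_. 0) = (\<lambda>_. 0)" by (auto simp: transfer_def)
    then have "(P ^^ k) (\<lambda>_. 0) = (\<lambda>_. 0)" for k by (induction k) auto
    then show ?thesis
      using coupled_survival_bound[of "\<lambda>_. 0" "\<lambda>_. 0" x y k] that by (auto simp: u_def)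
  qed
  have u_nonneg: "u k x y \<ge> 0" for k x y
  proof (induction k arbitrary: x y)
    case (Suc k)
    have "0 \<le> Q (u k) x y"
      unfolding coupled_transfer_def
      by (intro sum_nonneg mult_nonneg_nonneg p_nonneg) (use Suc in auto)
    then show ?case by (simp add: u_def[abs_def])
  qed (simp add: u_def)
  \<comment> \<open>\<open>u N \<le> 1 - \<epsilon>\<close> holds only for \<open>N\<close> steps; summing \<open>u k\<close> over \<open>k < N\<close> turns it into a
    one-step decrease, since \<open>Q S - S\<close> telescopes to \<open>u N - 1\<close>.\<close>
  define S where "S x y = (\<Sum>k<N. u k x y)" for x y
  have S_ge: "S x y \<ge> 1" for x y
  proof -
    have "u 0 x y \<le> S x y"
      unfolding S_def by (rule member_le_sum) (use N u_nonneg in auto)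
    then show ?thesis by (simp add: u_def)
  qed
  have S_le: "S x y \<le> N" if "x \<in> {0<..<1}" "y \<in> {0<..<1}" "x < y" for x y
    using sum_bounded_above[of "{..<N}" "\<lambda>k. u k x y" 1] u_le[OF that] by (simp add: S_def)
  have "Q S x y = (\<Sum>k<N. Q (u k) x y)" for x y
  proof -
    have "Q S x y = (\<Sum>i=1..m. \<Sum>j=1..m. \<Sum>k<N.
        p i * p j * (if f i x < f j y then u k (f i x) (f j y) else 0))"
      unfolding coupled_transfer_def S_def
      by (intro sum.cong refl) (simp add: sum_distrib_left)
    also have "\<dots> = (\<Sum>k<N. Q (u k) x y)"
      unfolding coupled_transfer_def
      by (subst (2) sum.swap, subst sum.swap) (simp add: sum.swap[of _ "{..<N}"])
    finally show ?thesis .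
  qed
  moreover have "Q (u k) = u (Suc k)" for k by (auto simp: u_def[abs_def])
  ultimately have QS: "Q S x y = S x y + u N x y - 1" for x y
    using sum.lessThan_Suc_shift[of "\<lambda>k. u k x y" N] by (simp add: S_def u_def)
  \<comment> \<open>The possible increase \<open>\<beta> * K\<close> of the weighted drift term then
    uses up only half of the decrease \<open>\<epsilon>\<close> of \<open>S\<close> in the compact
    part.\<close>
  define \<beta> where "\<beta> = \<epsilon> / (2 * K)"
  have \<beta>: "\<beta> > 0" "\<beta> * K = \<epsilon> / 2" using N K by (auto simp: \<beta>_def)
  define V where "V x y = S x y + \<beta> * W x y" for x y
  \<comment> \<open>Since \<open>S \<le> N\<close>, the first entry gives
    \<open>(1 - q) * S \<le> \<epsilon> / 2\<close> for the compact part, and the third gives the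
    quarter of \<open>\<beta> * (1 - \<rho>)\<close> needed outside it. The middle entry is the rate
    left for \<open>W\<close>.\<close>
  define q where "q = max (1 - \<epsilon> / (2 * N)) (max ((1 + \<rho>) / 2) (1 - \<beta> * (1 - \<rho>) / (4 * N)))"
  have "q < 1" using N \<beta> \<rho> by (simp add: q_def)
  moreover have "1 - \<epsilon> / (2 * N) \<le> q" "(1 + \<rho>) / 2 \<le> q" "1 - \<beta> * (1 - \<rho>) / (4 * N) \<le> q"
    unfolding q_def by linarith+
  ultimately have q: "q < 1" "1 - q \<le> \<epsilon> / (2 * N)" "(1 + \<rho>) / 2 \<le> q" "1 - q \<le> \<beta> * (1 - \<rho>) / (4 * N)"
    by linarith+
  have V_eq: "Q V x y = Q S x y + \<beta> * Q W x y" for x y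
    unfolding coupled_transfer_def V_def sum_distrib_left sum.distrib[symmetric]
    by (intro sum.cong refl) (simp add: algebra_simps)
  show thesis
  proof
    show "q \<in> {0<..<1}" using q \<rho> by auto
    fix x y :: real assume xy: "x \<in> {0<..<1}" "y \<in> {0<..<1}" "x < y"
    show "1 \<le> V x y"
      using S_ge[of x y] W_nonneg[OF xy(1,2)] \<beta> by (simp add: V_def add_increasing2)
    have "Q V x y \<le> S x y + u N x y - 1 + \<beta> * (\<rho> * W x y + K)"
      unfolding V_eq QS using QW[OF xy(1,2)] \<beta> by simp
    then have QV: "Q V x y \<le> S x y + u N x y - 1 + \<beta> * \<rho> * W x y + \<epsilon> / 2"
      using \<beta> by (simp add: algebra_simps)
    have *: "(1 - q) * S x y \<le> (1 - q) * N"
      using S_le[OF xy] q by (intro mult_left_mono) auto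
    show "Q V x y \<le> q * V x y"
    proof (cases "W x y \<le> R")
      case True
      then have "W0 x \<le> R" "W1 y \<le> R" using W0(1) W1(1) xy by (auto simp: W_def add_increasing add_increasing2 intro: order_trans[rotated])
      then have "u N x y \<le> 1 - \<epsilon>"
        unfolding u_def using xy a(2)[of x] b(2)[of y] by (intro cross) auto
      moreover have "(1 - q) * N \<le> \<epsilon> / 2"
        using q(2) N by (simp add: field_simps)
      moreover have "\<beta> * \<rho> * W x y \<le> q * (\<beta> * W x y)"
        using mult_right_mono[of \<rho> q "\<beta> * W x y"] q(3) \<rho> \<beta> W_nonneg[OF xy(1,2)]
        by (simp add: algebra_simps)
      ultimately show ?thesis using QV * by (simp add: V_def algebra_simps)
    next
      case False
      have "4 * K \<le> (1 - \<rho>) * W x y"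
      proof -
        have "4 * K / (1 - \<rho>) \<le> W x y" using False by (simp add: R_def)
        then show ?thesis using \<rho> by (simp add: field_simps)
      qed
      then have "\<beta> * (4 * K) \<le> \<beta> * ((1 - \<rho>) * W x y)" using \<beta> by (intro mult_left_mono) auto
      then have 1: "\<epsilon> / 2 \<le> \<beta> * (1 - \<rho>) * W x y / 4" using \<beta>(2) by (simp add: algebra_simps)
      have "(1 - q) * N \<le> \<beta> * (1 - \<rho>) / 4" using q(4) N by (simp add: field_simps)
      also have "\<dots> \<le> \<beta> * (1 - \<rho>) / 4 * W x y"
        using mult_left_mono[of 1 "W x y" "\<beta> * (1 - \<rho>) / 4"] False R \<beta> \<rho> by simp
      finally have 2: "(1 - q) * N \<le> \<beta> * (1 - \<rho>) * W x y / 4" by simp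
      have 3: "(1 + \<rho>) / 2 * (\<beta> * W x y) \<le> q * (\<beta> * W x y)"
        using q(3) \<beta> W_nonneg[OF xy(1,2)] by (intro mult_right_mono) auto
      \<comment> \<open>Near the endpoints no crossing is guaranteed; it is enough that
        \<open>S\<close> does not increase under \<open>Q\<close>.\<close>
      have "u N x y \<le> 1" by (rule u_le[OF xy])
      with QV * 1 2 3 show ?thesis by (simp add: V_def algebra_simps)
    qed
  qed
qed

end

section \<open>Drift towards the interior from positive Lyapunov exponents\<close>

text \<open>As a function of \<alpha>, the sum equals 1 at 0 and its derivative there is minus the
  Lyapunov exponent, so it drops below 1 for small positive \<alpha>.\<close>

lemma sum_powr_neg_less_one:
  fixes p r :: "'a \<Rightarrow> real"
  assumes "(\<Sum>i\<in>I. p i) = 1" "\<And>i. i \<in> I \<Longrightarrow> r i > 0" "(\<Sum>i\<in>I. p i * ln (r i)) > 0"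
  obtains \<alpha> where "\<alpha> > 0" "(\<Sum>i\<in>I. p i * r i powr (-\<alpha>)) < 1"
proof -
  let ?F = "\<lambda>\<alpha>. \<Sum>i\<in>I. p i * r i powr (-\<alpha>)"
  have "(?F has_real_derivative (\<Sum>i\<in>I. p i * (- ln (r i)))) (at 0)"
    by (rule DERIV_sum) (use assms(2) in \<open>auto intro!: derivative_eq_intros simp: less_imp_neq[THEN not_sym]\<close>)
  then have "(?F has_real_derivative - (\<Sum>i\<in>I. p i * ln (r i))) (at 0)"
    by (simp add: sum_negf)
  from DERIV_neg_dec_right[OF this] assms(3)
  obtain d where "d > 0" "\<And>h. h > 0 \<Longrightarrow> h < d \<Longrightarrow> ?F (0 + h) < ?F 0"
    by (auto simp del: powr_zero_eq_one)
  moreover have "?F 0 = 1"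
    using assms(1,2) by (simp add: less_imp_neq[THEN not_sym] cong: sum.cong)
  ultimately show thesis by (intro that[of "d/2"]) auto
qed

text \<open>For the weight \<open>x powr (-\<alpha>)\<close> the one-step ratio near 0 tends to the
  mean of \<open>r i powr (-\<alpha>)\<close>, which is below 1 for a suitable \<alpha>. Away from 0
  monotonicity bounds the image weight by a constant.\<close>

lemma boundary_drift:
  fixes r :: "nat \<Rightarrow> real"
  assumes p: "\<And>i. i \<in> {1..m} \<Longrightarrow> p i > 0" "(\<Sum>i=1..m. p i) = 1"
    and maps: "\<And>i x. i \<in> {1..m} \<Longrightarrow> x \<in> {0<..<1} \<Longrightarrow> f i x \<in> {0<..<1}"
    and mono: "\<And>i x y. i \<in> {1..m} \<Longrightarrow> x \<in> {0<..<1} \<Longrightarrow> y \<in> {0<..<1} \<Longrightarrow> x < y \<Longrightarrow> f i x < f i y"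
    and r: "\<And>i. i \<in> {1..m} \<Longrightarrow> r i > 0"
      "\<And>i. i \<in> {1..m} \<Longrightarrow> ((\<lambda>x. f i x / x) \<longlongrightarrow> r i) (at_right 0)"
      "(\<Sum>i=1..m. p i * ln (r i)) > 0"
  obtains W \<rho> K where "\<And>x. W x \<ge> 0" "\<rho> < 1"
    "\<And>x. x \<in> {0<..<1} \<Longrightarrow> transfer m p f W x \<le> \<rho> * W x + K"
    "\<And>R. \<exists>a>0. \<forall>x\<in>{0<..<1}. W x \<le> R \<longrightarrow> a \<le> x"
proof -
  obtain \<alpha> where \<alpha>: "\<alpha> > 0" "(\<Sum>i=1..m. p i * r i powr (-\<alpha>)) < 1"
    using sum_powr_neg_less_one[OF p(2) r(1,3)] by blast
  obtain \<rho> where \<rho>: "(\<Sum>i=1..m. p i * r i powr (-\<alpha>)) < \<rho>" "\<rho> < 1"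
    using \<alpha>(2) dense by blast
  have "0 \<le> (\<Sum>i=1..m. p i * r i powr (-\<alpha>))"
    by (intro sum_nonneg mult_nonneg_nonneg) (use p(1) in \<open>auto intro: less_imp_le\<close>)
  with \<rho> have "\<rho> > 0" by linarith
  have "((\<lambda>x. \<Sum>i=1..m. p i * (f i x / x) powr (-\<alpha>)) \<longlongrightarrow> (\<Sum>i=1..m. p i * r i powr (-\<alpha>))) (at_right 0)"
  proof (intro tendsto_sum tendsto_mult tendsto_const tendsto_powr r(2))
    fix i assume "i \<in> {1..m}"
    with r(1) show "r i \<noteq> 0" by force
  qed auto
  then have "\<forall>\<^sub>F x in at_right 0. (\<Sum>i=1..m. p i * (f i x / x) powr (-\<alpha>)) < \<rho>"
    using \<rho>(1) by (rule order_tendstoD)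
  then obtain b where b: "b > 0" "\<And>x. 0 < x \<Longrightarrow> x < b \<Longrightarrow> (\<Sum>i=1..m. p i * (f i x / x) powr (-\<alpha>)) < \<rho>"
    unfolding eventually_at_right_field by blast
  define \<delta> where "\<delta> = min b 1 / 2"
  have \<delta>: "\<delta> \<in> {0<..<1}" "\<delta> < b" using b(1) by (auto simp: \<delta>_def)
  \<comment> \<open>This is the averaged weight at \<open>\<delta>\<close>. It bounds the averaged
    weight at every larger point, because the maps increase and the weight decreases.\<close>
  define K where "K = (\<Sum>i=1..m. p i * f i \<delta> powr (-\<alpha>))"
  have K: "K \<ge> 0"
    unfolding K_def by (intro sum_nonneg mult_nonneg_nonneg) (use p(1) in \<open>auto intro: less_imp_le\<close>)
  show thesis
  proof (rule that[of "\<lambda>x. x powr (-\<alpha>)" \<rho> K])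
    fix x :: real assume x: "x \<in> {0<..<1}"
    show "transfer m p f (\<lambda>x. x powr (-\<alpha>)) x \<le> \<rho> * x powr (-\<alpha>) + K"
    proof (cases "x < \<delta>")
      case True
      have "transfer m p f (\<lambda>x. x powr (-\<alpha>)) x = (\<Sum>i=1..m. p i * (f i x / x) powr (-\<alpha>)) * x powr (-\<alpha>)"
        unfolding transfer_def sum_distrib_right
      proof (intro sum.cong refl)
        fix i assume "i \<in> {1..m}"
        then have "f i x > 0" using maps x by force
        then show "p i * f i x powr (-\<alpha>) = p i * (f i x / x) powr (-\<alpha>) * x powr (-\<alpha>)"
          using x by (simp add: powr_divide)
      qed
      also have "\<dots> \<le> \<rho> * x powr (-\<alpha>)"
        using b(2)[of x] x True \<delta> by (intro mult_right_mono) auto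
      finally show ?thesis using K by simp
    next
      case False
      have "transfer m p f (\<lambda>x. x powr (-\<alpha>)) x \<le> K"
        unfolding transfer_def K_def
      proof (intro sum_mono mult_left_mono powr_mono2')
        fix i assume i: "i \<in> {1..m}"
        show "f i \<delta> \<le> f i x" using mono[OF i \<delta>(1) x] False by (cases "x = \<delta>") auto
        show "0 < f i \<delta>" using maps[OF i \<delta>(1)] by simp
        show "0 \<le> p i" using p(1)[OF i] by simp
      qed (use \<alpha> in auto)
      then show ?thesis using \<open>\<rho> > 0\<close> by (simp add: add_increasing)
    qed
  next
    fix R :: real
    \<comment> \<open>A level \<open>R \<le> 0\<close> has no positive power to serve as
      \<open>a\<close>; raising it to at least 1 keeps the witness positive and only enlarges the
      sublevel set.\<close>
    define R' where "R' = max R 1"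
    show "\<exists>a>0. \<forall>x\<in>{0<..<1}. x powr (-\<alpha>) \<le> R \<longrightarrow> a \<le> x"
    proof (intro exI[of _ "R' powr (-1/\<alpha>)"] conjI ballI impI)
      show "R' powr (-1/\<alpha>) > 0" by (simp add: R'_def)
      fix x :: real assume x: "x \<in> {0<..<1}" "x powr (-\<alpha>) \<le> R"
      then have "R' powr (-1/\<alpha>) \<le> (x powr (-\<alpha>)) powr (-1/\<alpha>)"
        using \<alpha> by (intro powr_mono2') (auto simp: R'_def)
      also have "\<dots> = x" using x \<alpha> by (simp add: powr_powr)
      finally show "R' powr (-1/\<alpha>) \<le> x" .
    qed
  qed (use \<rho> in auto)
qed

section \<open>Expected distances and the exponential bound\<close>

context interval_maps begin

lemma random_iterate_mono:
  assumes "\<And>k. k \<in> {1..n} \<Longrightarrow> \<omega> k \<in> {1..m}" "x \<in> {0<..<1}" "y \<in> {0<..<1}" "x < y"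
  shows "random_iterate f \<omega> n x < random_iterate f \<omega> n y"
  using assms(1)
proof (induction n)
  case (Suc n)
  have \<omega>: "\<And>k. k \<in> {1..n} \<Longrightarrow> \<omega> k \<in> {1..m}" "\<omega> (Suc n) \<in> {1..m}"
    using Suc.prems by auto
  have "random_iterate f \<omega> n z \<in> {0<..<1}" if "z \<in> {0<..<1}" for z
    using random_iterate_in[of n \<omega> "{1..m}" "{0<..<1}" f z] \<omega>(1) maps that by blast
  then show ?case
    using f_mono[OF \<omega>(2)] Suc.IH[OF \<omega>(1)] assms(2,3) by simp
qed (use assms in simp)

lemma expected_distance:
  assumes xy: "x \<in> {0<..<1}" "y \<in> {0<..<1}" "x < y"
  shows "(\<integral>\<omega>. \<bar>random_iterate f \<omega> n x - random_iterate f \<omega> n y\<bar> \<partial>bernoulli_measure m p)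
    = (P ^^ n) (\<lambda>z. z) y - (P ^^ n) (\<lambda>z. z) x"
proof -
  have E: "integrable (bernoulli_measure m p) (\<lambda>\<omega>. random_iterate f \<omega> n z)"
    "(\<integral>\<omega>. random_iterate f \<omega> n z \<partial>bernoulli_measure m p) = (P ^^ n) (\<lambda>z. z) z"
    if "z \<in> {0<..<1}" for z
    using integral_random_iterate[of m p "{0<..<1}" f z "\<lambda>z. z" 1 n] p_nonneg p_sum maps that
    by auto
  have "(\<integral>\<omega>. \<bar>random_iterate f \<omega> n x - random_iterate f \<omega> n y\<bar> \<partial>bernoulli_measure m p)
      = (\<integral>\<omega>. random_iterate f \<omega> n y - random_iterate f \<omega> n x \<partial>bernoulli_measure m p)"
  proof (rule Bochner_Integration.integral_cong[OF refl])
    fix \<omega> assume "\<omega> \<in> space (bernoulli_measure m p)"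
    then have "random_iterate f \<omega> n x < random_iterate f \<omega> n y"
      by (intro random_iterate_mono xy)
         (auto simp: bernoulli_measure_def space_PiM PiE_def Pi_def space_point_measure)
    then show "\<bar>random_iterate f \<omega> n x - random_iterate f \<omega> n y\<bar>
        = random_iterate f \<omega> n y - random_iterate f \<omega> n x" by simp
  qed
  also have "\<dots> = (P ^^ n) (\<lambda>z. z) y - (P ^^ n) (\<lambda>z. z) x"
    using E xy by simp
  finally show ?thesis .
qed

end

lemma increasing_C2_diffeo_maps:
  assumes "increasing_C2_diffeo g"
  shows "g 0 = 0" "g 1 = 1" "x \<in> {0<..<1} \<Longrightarrow> g x \<in> {0<..<1}"
proof -
  have img: "g ` {0..1} = {0..1}" and mono: "strict_mono_on {0..1} g"
    using assms by (auto simp: increasing_C2_diffeo_def bij_betw_def)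
  have le: "g u \<le> g v" if "u \<in> {0..1}" "v \<in> {0..1}" "u \<le> v" for u v
    using strict_mono_onD[OF mono that(1,2)] that(3) by (cases "u = v") auto
  have g01: "g u \<in> {0..1}" if "u \<in> {0..1}" for u using img that by blast
  have "0 \<in> g ` {0..1}" "1 \<in> g ` {0..1}" unfolding img by auto
  then obtain u v where uv: "u \<in> {0..1}" "g u = 0" "v \<in> {0..1}" "g v = 1"
    by fastforce
  show g0: "g 0 = 0" using le[of 0 u] g01[of 0] uv by auto
  show g1: "g 1 = 1" using le[of v 1] g01[of 1] uv by auto
  show "g x \<in> {0<..<1}" if "x \<in> {0<..<1}"
    using strict_mono_onD[OF mono, of 0 x] strict_mono_onD[OF mono, of x 1] g0 g1 that by auto
qed

theorem theorem1:
  fixes m :: nat and f :: "nat \<Rightarrow> real \<Rightarrow> real" and p :: "nat \<Rightarrow> real"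
  assumes p_pos: "\<And>i. i \<in> {1..m} \<Longrightarrow> p i > 0"
    and p_sum: "(\<Sum>i=1..m. p i) = 1"
    and A1: "\<And>i. i \<in> {1..m} \<Longrightarrow> increasing_C2_diffeo (f i)"
    and A2: "\<And>x. x \<in> {0<..<1} \<Longrightarrow> \<exists>i\<in>{1..m}. \<exists>j\<in>{1..m}. f i x < x \<and> x < f j x"
    and A3: "(\<Sum>i=1..m. p i * ln (deriv01 (f i) 0)) > 0"
            "(\<Sum>i=1..m. p i * ln (deriv01 (f i) 1)) > 0"
  shows "\<forall>x\<in>{0<..<1}. \<forall>y\<in>{0<..<1}. \<exists>C\<ge>1. \<exists>q\<in>{0<..<1}. \<forall>n\<ge>1.
           (\<integral>\<omega>. \<bar>random_iterate f \<omega> n x - random_iterate f \<omega> n y\<bar> \<partial>bernoulli_measure m p) \<le> C * q ^ n"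
proof -
  have D: "(f i has_real_derivative deriv01 (f i) x) (at x within {0..1})" "deriv01 (f i) x > 0"
    if "i \<in> {1..m}" "x \<in> {0..1}" for i x
    using increasing_C2_diffeo_derivative[OF A1] that by auto
  interpret interval_maps m p f
  proof
    fix i x y assume "i \<in> {1..m}" "x \<in> {0<..<1::real}" "y \<in> {0<..<1}" "x < y"
    then show "f i x < f i y"
      using A1[of i] strict_mono_onD[of "{0..1}" "f i" x y] by (simp add: increasing_C2_diffeo_def)
  next
    fix i assume "i \<in> {1..m}"
    then have "continuous_on {0..1} (f i)"
      by (intro DERIV_continuous_on[where D="deriv01 (f i)"] D(1))
    then show "continuous_on {0<..<1} (f i)" by (rule continuous_on_subset) auto
  next
    fix i x assume "i \<in> {1..m}" "x \<in> {0<..<1::real}"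
    then show "f i x \<in> {0<..<1}" using increasing_C2_diffeo_maps(3)[OF A1] by blast
  next
    fix x assume "x \<in> {0<..<1::real}"
    then show "\<exists>i\<in>{1..m}. \<exists>j\<in>{1..m}. f i x < x \<and> x < f j x" by (rule A2)
  qed (use p_pos p_sum in simp_all)
  interpret R: interval_maps m p "\<lambda>i x. 1 - f i (1 - x)" by (rule reflected)
  obtain W0 \<rho>0 K0 where W0: "\<And>x. W0 x \<ge> 0" "\<rho>0 < 1"
    "\<And>x. x \<in> {0<..<1} \<Longrightarrow> P W0 x \<le> \<rho>0 * W0 x + K0"
    "\<And>R. \<exists>a>0. \<forall>x\<in>{0<..<1}. W0 x \<le> R \<longrightarrow> a \<le> x"
  proof (rule boundary_drift[of m p f "\<lambda>i. deriv01 (f i) 0"])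
    fix i assume i: "i \<in> {1..m}"
    have "((\<lambda>y. (f i y - f i 0) / (y - 0)) \<longlongrightarrow> deriv01 (f i) 0) (at 0 within {0..1})"
      using D(1)[OF i, of 0] by (simp add: has_field_derivative_iff)
    then show "((\<lambda>x. f i x / x) \<longlongrightarrow> deriv01 (f i) 0) (at_right 0)"
      using increasing_C2_diffeo_maps(1)[OF A1[OF i]] by (simp add: at_within_Icc_at_right)
  qed (use p_pos p_sum maps f_mono D(2) A3(1) in auto)
  obtain W1 \<rho>1 K1 where W1: "\<And>x. W1 x \<ge> 0" "\<rho>1 < 1"
    "\<And>x. x \<in> {0<..<1} \<Longrightarrow> R.P W1 x \<le> \<rho>1 * W1 x + K1"
    "\<And>R. \<exists>a>0. \<forall>x\<in>{0<..<1}. W1 x \<le> R \<longrightarrow> a \<le> x"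
  proof (rule boundary_drift[of m p "\<lambda>i x. 1 - f i (1 - x)" "\<lambda>i. deriv01 (f i) 1"])
    fix i assume i: "i \<in> {1..m}"
    \<comment> \<open>The reflection maps the unit interval onto itself, so the one-sided chain rule
      applies. The inner and outer minus signs cancel, and the multiplier at 1 becomes that of the
      reflected map at 0.\<close>
    have "(f i has_real_derivative deriv01 (f i) 1) (at (1 - 0) within (\<lambda>x. 1 - x) ` {0..1})"
      using D(1)[OF i, of 1] by (simp add: image_diff_atLeastAtMost)
    moreover have "((\<lambda>x::real. 1 - x) has_real_derivative - 1) (at 0 within {0..1})"
      by (auto intro!: derivative_eq_intros)
    ultimately have "((\<lambda>x. f i (1 - x)) has_real_derivative deriv01 (f i) 1 * - 1) (at 0 within {0..1})"
      using DERIV_image_chain[of "f i" _ "\<lambda>x. 1 - x" 0 "{0..1}" "- 1"] by (simp add: comp_def)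
    then have "((\<lambda>x. 1 - f i (1 - x)) has_real_derivative deriv01 (f i) 1) (at 0 within {0..1})"
      by (auto intro!: derivative_eq_intros)
    then have "((\<lambda>x. (1 - f i (1 - x) - (1 - f i 1)) / (x - 0)) \<longlongrightarrow> deriv01 (f i) 1) (at 0 within {0..1})"
      by (simp add: has_field_derivative_iff)
    then show "((\<lambda>x. (1 - f i (1 - x)) / x) \<longlongrightarrow> deriv01 (f i) 1) (at_right 0)"
      using increasing_C2_diffeo_maps(2)[OF A1[OF i]] by (simp add: at_within_Icc_at_right)
  qed (use p_pos p_sum R.maps R.f_mono D(2) A3(2) in auto)
  \<comment> \<open>Undoing the reflection turns a drift away from 0 for the reflected maps into one
    away from 1 for the original maps.\<close>
  have W1_reflected: "P (\<lambda>z. W1 (1 - z)) x \<le> \<rho>1 * W1 (1 - x) + K1" if "x \<in> {0<..<1}" for x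
    using W1(3)[of "1 - x"] transfer_reflected[of 1 W1 "1 - x"] that by simp
  have W1_proper: "\<exists>b<1. \<forall>x\<in>{0<..<1}. W1 (1 - x) \<le> R \<longrightarrow> x \<le> b" for R
  proof -
    obtain a where a: "a > 0" "\<And>x. x \<in> {0<..<1} \<Longrightarrow> W1 x \<le> R \<Longrightarrow> a \<le> x" using W1(4) by blast
    show ?thesis
    proof (intro exI[of _ "1 - a"] conjI ballI impI)
      fix x :: real assume "x \<in> {0<..<1}" "W1 (1 - x) \<le> R"
      then show "x \<le> 1 - a" using a(2)[of "1 - x"] by simp
    qed (use a(1) in simp)
  qed
  obtain V q where q: "q \<in> {0<..<1}"
    and V: "\<And>x y. x \<in> {0<..<1} \<Longrightarrow> y \<in> {0<..<1} \<Longrightarrow> x < y \<Longrightarrow> 1 \<le> V x y"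
    and QV: "\<And>x y. x \<in> {0<..<1} \<Longrightarrow> y \<in> {0<..<1} \<Longrightarrow> x < y \<Longrightarrow> Q V x y \<le> q * V x y"
    using exponential_from_drift[OF W0(1,3,4,2) W1(1) W1_reflected W1_proper W1(2)] by metis
  let ?E = "\<lambda>n x y. \<integral>\<omega>. \<bar>random_iterate f \<omega> n x - random_iterate f \<omega> n y\<bar> \<partial>bernoulli_measure m p"
  have ordered: "?E n x y \<le> V x y * q ^ n" if "x \<in> {0<..<1}" "y \<in> {0<..<1}" "x < y" for n x y
  proof -
    have "(P ^^ n) (\<lambda>z. z) y - (P ^^ n) (\<lambda>z. z) x \<le> q ^ n * V x y"
    proof (rule monotone_difference_bound)
      fix u v :: real assume "u \<in> {0<..<1}" "v \<in> {0<..<1}" "u < v"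
      \<comment> \<open>Points of the unit interval differ by less than 1, so the lower bound 1 on
        \<open>V\<close> dominates the initial distance.\<close>
      then show "v - u \<le> V u v" using V[of u v] by auto
    qed (use that q QV in auto)
    then show ?thesis by (simp add: expected_distance[OF that] mult.commute)
  qed
  show ?thesis
  proof (intro ballI)
    fix x y :: real assume xy: "x \<in> {0<..<1}" "y \<in> {0<..<1}"
    \<comment> \<open>The rate was fixed before the points; only the constant, \<open>V\<close> at
      the ordered pair, depends on them.\<close>
    have "\<exists>C\<ge>1. \<forall>n. ?E n x y \<le> C * q ^ n"
    proof (cases x y rule: linorder_cases)
      case less
      then show ?thesis using ordered[of x y] V[of x y] xy by auto
    next
      case equal
      then show ?thesis using q by (intro exI[of _ 1]) auto
    next
      case greater
      then show ?thesis using ordered[of y x] V[of y x] xy by (auto simp: abs_minus_commute)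
    qed
    then show "\<exists>C\<ge>1. \<exists>q\<in>{0<..<1}. \<forall>n\<ge>1. ?E n x y \<le> C * q ^ n"
      using q by blast
  qed
qed

end
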